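(* Let $k\ge 2$, let $H=\mathbf S(\{1,2\})\times\mathbf S(\{3,\dots,k\})\cong S_2\times S_{k-2}$, a subgroup of $S_k$ of index $\frac{k(k-1)}2$, and let $f\colon B_k\to S_{k(k-1)/2}$ be the homomorphism derived from the canonical epimorphism $\mu_k\colon B_k\to S_k$ using $H$, i.e. the homomorphism sending each $\sigma_i$ to the permutation that $\mu_k(\sigma_i)=(i,i+1)$ induces on the $\frac{k(k-1)}2$ cosets of $H$ in $S_k$ by left multiplication. Then $f$ is transitive and non-cyclic. Moreover, if $k$ is even then $k\nmid\frac{k(k-1)}2$, and so, for any even $k$, this example refutes the conjecture that there is no non-cyclic transitive homomorphism $B_k\to S_n$ for $k\nmid n$.
   Context: $B_k$ is the braid group on $k$ strings, with generators $\sigma_1,\dots,\sigma_{k-1}$ and relations $\sigma_i\sigma_j=\sigma_j\sigma_i$ for $|i-j|\ge2$ and $\sigma_i\sigma_{i+1}\sigma_i=\sigma_{i+1}\sigma_i\sigma_{i+1}$ for $1\le i\le k-2$. $S_n$ is the symmetric group on $\{1,\dots,n\}$ and $\mathbf S(\Gamma)$ is the symmetric group on a set $\Gamma$; for $\Sigma\subseteq\Gamma$, $\mathbf S(\Sigma)$ is identified with the subgroup of $\mathbf S(\Gamma)$ of permutations supported in $\Sigma$. The canonical epimorphism $\mu_k\colon B_k\to S_k$ is given by $\mu_k(\sigma_i)=(i,i+1)$. A homomorphism to $S_n$ is transitive if its image acts transitively on $\{1,\dots,n\}$, and cyclic if its image is a cyclic subgroup of $S_n$. The set of cosets of $H$ is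 identified with $\{1,\dots,\frac{k(k-1)}2\}$ by any bijection.
   Formalization: Non-cyclicity of f and the refutation of the conjecture are stated only for k > 2: for k = 2 the target is the trivial group S_1, so f is cyclic, and B_2 is infinite cyclic, so the conjecture holds there. *)

theory Defs
  imports "HOL-Algebra.Sym_Groups" "HOL-Algebra.Left_Coset" "HOL-Algebra.Elementary_Groups"
begin

section \<open>The braid group\<close>

text \<open>\<open>B\<^sub>k\<close> is given by its presentation, as words modulo the congruence generated by free
  cancellation and the braid relations. The letter \<open>(i, True)\<close> stands for \<open>\<sigma>\<^sub>i\<close> and
  \<open>(i, False)\<close> for its inverse.\<close>

type_synonym braid_word = "(nat \<times> bool) list"

definition braid_words :: "nat \<Rightarrow> braid_word set"
  where "braid_words k = lists ({1..<k} \<times> UNIV)"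

inductive braid_eq :: "nat \<Rightarrow> braid_word \<Rightarrow> braid_word \<Rightarrow> bool" for k
  where
    refl: "u \<in> braid_words k \<Longrightarrow> braid_eq k u u"
  | sym: "braid_eq k u v \<Longrightarrow> braid_eq k v u"
  | trans: "braid_eq k u v \<Longrightarrow> braid_eq k v w \<Longrightarrow> braid_eq k u w"
  | ctxt: "braid_eq k u v \<Longrightarrow> a \<in> braid_words k \<Longrightarrow> b \<in> braid_words k \<Longrightarrow>
      braid_eq k (a @ u @ b) (a @ v @ b)"
  | cancel: "i \<in> {1..<k} \<Longrightarrow> braid_eq k [(i, s), (i, \<not> s)] []"
  | comm: "i \<in> {1..<k} \<Longrightarrow> j \<in> {1..<k} \<Longrightarrow> \<bar>int i - int j\<bar> \<ge> 2 \<Longrightarrow>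
      braid_eq k [(i, True), (j, True)] [(j, True), (i, True)]"
  | braid: "1 \<le> i \<Longrightarrow> i + 2 \<le> k \<Longrightarrow>
      braid_eq k [(i, True), (i + 1, True), (i, True)] [(i + 1, True), (i, True), (i + 1, True)]"

definition braid_rel :: "nat \<Rightarrow> (braid_word \<times> braid_word) set"
  where "braid_rel k = {(u, v). braid_eq k u v}"

definition braid_group :: "nat \<Rightarrow> braid_word set monoid"
  where "braid_group k =
    \<lparr>carrier = braid_words k // braid_rel k,
     mult = (\<lambda>A B. \<Union>a\<in>A. \<Union>b\<in>B. braid_rel k `` {a @ b}),
     one = braid_rel k `` {[]}\<rparr>"

definition braid_gen :: "nat \<Rightarrow> nat \<Rightarrow> braid_word set"
  where "braid_gen k i = braid_rel k `` {[(i, True)]}"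

lemma braid_eq_words: "braid_eq k u v \<Longrightarrow> u \<in> braid_words k \<and> v \<in> braid_words k"
  by (induction rule: braid_eq.induct) (auto simp: braid_words_def)

lemma equiv_braid_rel: "equiv (braid_words k) (braid_rel k)"
  by (rule equivI) (auto simp: braid_rel_def refl_on_def sym_def trans_def
      dest: braid_eq_words intro: braid_eq.refl braid_eq.sym braid_eq.trans)

lemma braid_words_append: "u \<in> braid_words k \<Longrightarrow> v \<in> braid_words k \<Longrightarrow> u @ v \<in> braid_words k"
  by (auto simp: braid_words_def)

lemma Nil_braid_words [simp]: "[] \<in> braid_words k"
  by (auto simp: braid_words_def)

lemma braid_eq_append:
  assumes "braid_eq k u v" "braid_eq k u' v'"
  shows "braid_eq k (u @ u') (v @ v')"
proof -
  have "braid_eq k ([] @ u @ u') ([] @ v @ u')"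
    using assms braid_eq_words by (intro braid_eq.ctxt) auto
  moreover have "braid_eq k (v @ u' @ []) (v @ v' @ [])"
    using assms braid_eq_words by (intro braid_eq.ctxt) auto
  ultimately show ?thesis using braid_eq.trans by auto
qed

lemma braid_mult_class:
  assumes "u \<in> braid_words k" "v \<in> braid_words k"
  shows "(braid_rel k `` {u}) \<otimes>\<^bsub>braid_group k\<^esub> (braid_rel k `` {v}) = braid_rel k `` {u @ v}"
proof -
  have "congruent2 (braid_rel k) (braid_rel k) (\<lambda>a b. braid_rel k `` {a @ b})"
  proof (rule congruent2I')
    fix a b c d assume "(a, b) \<in> braid_rel k" "(c, d) \<in> braid_rel k"
    then have "(a @ c, b @ d) \<in> braid_rel k"
      using braid_eq_append by (simp add: braid_rel_def)
    then show "braid_rel k `` {a @ c} = braid_rel k `` {b @ d}"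
      by (rule equiv_class_eq[OF equiv_braid_rel])
  qed
  from UN_equiv_class2[OF equiv_braid_rel equiv_braid_rel this assms]
  show ?thesis by (simp add: braid_group_def)
qed

lemma braid_class_closed:
  "u \<in> braid_words k \<Longrightarrow> braid_rel k `` {u} \<in> carrier (braid_group k)"
  by (simp add: braid_group_def quotientI)

lemma braid_class_cases:
  assumes "A \<in> carrier (braid_group k)"
  obtains u where "u \<in> braid_words k" "A = braid_rel k `` {u}"
  using assms by (auto simp: braid_group_def elim: quotientE)

definition word_inverse :: "braid_word \<Rightarrow> braid_word"
  where "word_inverse w = rev (map (\<lambda>(i, s). (i, \<not> s)) w)"

lemma word_inverse_words: "w \<in> braid_words k \<Longrightarrow> word_inverse w \<in> braid_words k"
  by (fastforce simp: word_inverse_def braid_words_def lists_eq_set)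

lemma word_inverse_left: "w \<in> braid_words k \<Longrightarrow> braid_eq k (word_inverse w @ w) []"
proof (induction w)
  case Nil
  then show ?case by (simp add: word_inverse_def braid_eq.refl)
next
  case (Cons x w)
  obtain i s where x: "x = (i, s)" by (cases x)
  have i: "i \<in> {1..<k}" and w: "w \<in> braid_words k" using Cons.prems by (auto simp: x braid_words_def)
  have "braid_eq k (word_inverse w @ [(i, \<not> s), (i, \<not> \<not> s)] @ w) (word_inverse w @ [] @ w)"
    by (intro braid_eq.ctxt braid_eq.cancel i word_inverse_words w)
  then show ?case using Cons.IH[OF w] by (auto simp: x word_inverse_def intro: braid_eq.trans)
qed

lemma group_braid_group: "group (braid_group k)"
proof (rule groupI)
  have one: "\<one>\<^bsub>braid_group k\<^esub> = braid_rel k `` {[]}" by (simp add: braid_group_def)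
  show "\<one>\<^bsub>braid_group k\<^esub> \<in> carrier (braid_group k)"
    by (simp add: one braid_class_closed)
  fix x assume "x \<in> carrier (braid_group k)"
  then obtain u where u: "u \<in> braid_words k" "x = braid_rel k `` {u}" by (rule braid_class_cases)
  show "\<one>\<^bsub>braid_group k\<^esub> \<otimes>\<^bsub>braid_group k\<^esub> x = x"
    using u by (simp add: one braid_mult_class)
  have "braid_rel k `` {word_inverse u} \<otimes>\<^bsub>braid_group k\<^esub> x = \<one>\<^bsub>braid_group k\<^esub>"
    using u word_inverse_left[of u k]
      equiv_class_eq[OF equiv_braid_rel, of "word_inverse u @ u" "[]" k]
    by (simp add: one braid_mult_class word_inverse_words) (simp add: braid_rel_def)
  then show "\<exists>y\<in>carrier (braid_group k). y \<otimes>\<^bsub>braid_group k\<^esub> x = \<one>\<^bsub>braid_group k\<^esub>"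
    using u by (meson braid_class_closed word_inverse_words)
  fix y assume "y \<in> carrier (braid_group k)"
  then obtain v where v: "v \<in> braid_words k" "y = braid_rel k `` {v}" by (rule braid_class_cases)
  show "x \<otimes>\<^bsub>braid_group k\<^esub> y \<in> carrier (braid_group k)"
    using u v by (simp add: braid_mult_class braid_class_closed braid_words_append)
  fix z assume "z \<in> carrier (braid_group k)"
  then obtain w where w: "w \<in> braid_words k" "z = braid_rel k `` {w}" by (rule braid_class_cases)
  show "x \<otimes>\<^bsub>braid_group k\<^esub> y \<otimes>\<^bsub>braid_group k\<^esub> z =
      x \<otimes>\<^bsub>braid_group k\<^esub> (y \<otimes>\<^bsub>braid_group k\<^esub> z)"
    using u v w by (simp add: braid_mult_class braid_words_append)
qed

section \<open>The canonical epimorphism\<close>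

definition word_perm :: "braid_word \<Rightarrow> nat \<Rightarrow> nat"
  where "word_perm w =
    foldr (\<lambda>(i, s) p. (if s then transpose i (i + 1) else inv' (transpose i (i + 1))) \<circ> p) w id"

text \<open>All words in a class have the same permutation, so the image below is a singleton.\<close>

definition canonical_epi :: "nat \<Rightarrow> braid_word set \<Rightarrow> nat \<Rightarrow> nat"
  where "canonical_epi k A = the_elem (word_perm ` A)"

lemma word_perm_Nil [simp]: "word_perm [] = id"
  by (simp add: word_perm_def)

lemma word_perm_Cons [simp]: "word_perm ((i, s) # w) = transpose i (i + 1) \<circ> word_perm w"
  by (simp add: word_perm_def inv_unique_comp)

lemma word_perm_append [simp]: "word_perm (u @ v) = word_perm u \<circ> word_perm v"
  by (induction u) (auto simp: comp_assoc)

lemma word_perm_permutes: "w \<in> braid_words k \<Longrightarrow> word_perm w permutes {1..k}"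
proof (induction w)
  case Nil
  then show ?case using permutes_id by (simp add: id_def)
next
  case (Cons x w)
  obtain i s where x: "x = (i, s)" by (cases x)
  have "i \<in> {1..<k}" "w \<in> braid_words k" using Cons.prems by (auto simp: x braid_words_def)
  then have "transpose i (i + 1) \<circ> word_perm w permutes {1..k}"
    using Cons.IH by (intro permutes_compose permutes_swap_id) auto
  then show ?case by (simp only: x word_perm_Cons)
qed

lemma word_perm_eq: "braid_eq k u v \<Longrightarrow> word_perm u = word_perm v"
proof (induction rule: braid_eq.induct)
  case (comm i j)
  then show ?case by (auto simp: fun_eq_iff transpose_def)
next
  case (braid i)
  then show ?case by (auto simp: fun_eq_iff transpose_def)
qed (auto simp: fun_eq_iff)

lemma canonical_epi_class:
  assumes "u \<in> braid_words k"
  shows "canonical_epi k (braid_rel k `` {u}) = word_perm u"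
proof -
  have "word_perm ` (braid_rel k `` {u}) = {word_perm u}"
    using assms by (auto simp: braid_rel_def image_iff dest: word_perm_eq intro: braid_eq.refl)
  then show ?thesis by (simp add: canonical_epi_def)
qed

lemma canonical_epi_gen: "i \<in> {1..<k} \<Longrightarrow> canonical_epi k (braid_gen k i) = transpose i (i + 1)"
  by (simp add: braid_gen_def canonical_epi_class braid_words_def)

lemma canonical_epi_hom: "canonical_epi k \<in> hom (braid_group k) (sym_group k)"
proof (rule homI)
  fix x assume "x \<in> carrier (braid_group k)"
  then obtain u where u: "u \<in> braid_words k" "x = braid_rel k `` {u}" by (rule braid_class_cases)
  show "canonical_epi k x \<in> carrier (sym_group k)"
    using u word_perm_permutes unfolding sym_group_carrier by (simp add: canonical_epi_class)
  fix y assume "y \<in> carrier (braid_group k)"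
  then obtain v where v: "v \<in> braid_words k" "y = braid_rel k `` {v}" by (rule braid_class_cases)
  show "canonical_epi k (x \<otimes>\<^bsub>braid_group k\<^esub> y) =
      canonical_epi k x \<otimes>\<^bsub>sym_group k\<^esub> canonical_epi k y"
    using u v
    by (simp add: braid_mult_class canonical_epi_class braid_words_append sym_group_mult)
qed

lemma word_perm_transpose:
  assumes "1 \<le> a" "a < b" "b \<le> k"
  shows "\<exists>w\<in>braid_words k. word_perm w = transpose a b"
  using assms
proof (induction b)
  case (Suc b)
  show ?case
  proof (cases "a = b")
    case True
    then show ?thesis using Suc.prems
      by (intro bexI[of _ "[(a, True)]"]) (auto simp: braid_words_def)
  next
    case False
    then obtain w where w: "w \<in> braid_words k" "word_perm w = transpose a b"
      using Suc by auto
    have "transpose b (b + 1) \<circ> transpose a b \<circ> transpose b (b + 1) = transpose a (Suc b)"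
      using False Suc.prems by (auto simp: fun_eq_iff transpose_def)
    then show ?thesis using w Suc.prems False
      by (intro bexI[of _ "(b, True) # w @ [(b, True)]"]) (auto simp: braid_words_def comp_assoc)
  qed
qed simp

lemma word_perm_surj:
  assumes "p permutes {1..k}"
  shows "\<exists>w\<in>braid_words k. word_perm w = p"
  using finite_atLeastAtMost assms
proof (induction rule: permutes_rev_induct)
  case id
  show ?case by (intro bexI[of _ "[]"]) auto
next
  case (swap a b p)
  then obtain w where w: "w \<in> braid_words k" "word_perm w = p" by auto
  have "\<exists>v\<in>braid_words k. word_perm v = transpose a b"
    using swap word_perm_transpose[of a b k] word_perm_transpose[of b a k]
    by (cases a b rule: linorder_cases)
      (auto simp: transpose_commute intro: bexI[of _ "[]"])
  then obtain v where v: "v \<in> braid_words k" "word_perm v = transpose a b" by auto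
  then show ?case using w by (intro bexI[of _ "w @ v"]) (auto intro: braid_words_append)
qed

lemma canonical_epi_epi: "canonical_epi k \<in> epi (braid_group k) (sym_group k)"
proof -
  have "carrier (sym_group k) \<subseteq> canonical_epi k ` carrier (braid_group k)"
  proof
    fix p assume "p \<in> carrier (sym_group k)"
    then obtain w where "w \<in> braid_words k" "word_perm w = p"
      using word_perm_surj[of p k] unfolding sym_group_carrier by blast
    then show "p \<in> canonical_epi k ` carrier (braid_group k)"
      by (metis braid_class_closed canonical_epi_class imageI)
  qed
  then show ?thesis
    using canonical_epi_hom by (auto simp: epi_def hom_def)
qed

section \<open>Homomorphisms to symmetric groups\<close>

definition transitive_hom :: "('a, 'b) monoid_scheme \<Rightarrow> nat \<Rightarrow> ('a \<Rightarrow> nat \<Rightarrow> nat) \<Rightarrow> bool"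
  where "transitive_hom G n f \<longleftrightarrow>
    (\<forall>x\<in>{1..n}. \<forall>y\<in>{1..n}. \<exists>p \<in> f ` carrier G. p x = y)"

definition cyclic_hom :: "('a, 'b) monoid_scheme \<Rightarrow> nat \<Rightarrow> ('a \<Rightarrow> nat \<Rightarrow> nat) \<Rightarrow> bool"
  where "cyclic_hom G n f \<longleftrightarrow>
    cyclic_group ((sym_group n)\<lparr>carrier := f ` carrier G\<rparr>)"

text \<open>The permutation that left multiplication by \<open>g\<close> induces on the left cosets of \<open>H\<close>,
  transported to \<open>{1..n}\<close> along a numbering \<open>\<phi>\<close> of the cosets.\<close>

definition coset_perm ::
    "('a, 'b) monoid_scheme \<Rightarrow> 'a set \<Rightarrow> nat \<Rightarrow> ('a set \<Rightarrow> nat) \<Rightarrow> 'a \<Rightarrow> nat \<Rightarrow> nat"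
  where "coset_perm G H n \<phi> g =
    (\<lambda>x. if x \<in> {1..n} then \<phi> (g <#\<^bsub>G\<^esub> inv_into (lcosets\<^bsub>G\<^esub> H) \<phi> x) else x)"

text \<open>The homomorphism derived from \<open>\<mu>\<close> (a homomorphism to \<open>G\<close>) using \<open>H\<close>.\<close>

definition derived_hom ::
    "('a, 'b) monoid_scheme \<Rightarrow> 'a set \<Rightarrow> nat \<Rightarrow> ('a set \<Rightarrow> nat) \<Rightarrow> ('c \<Rightarrow> 'a) \<Rightarrow> 'c \<Rightarrow> nat \<Rightarrow> nat"
  where "derived_hom G H n \<phi> \<mu> = (\<lambda>b. coset_perm G H n \<phi> (\<mu> b))"

text \<open>\<open>\<^bold>S(A) \<times> \<^bold>S(B)\<close>, for disjoint \<open>A\<close> and \<open>B\<close>, as an internal product of subgroups of \<open>S\<^sub>k\<close>.\<close>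

definition young_subgroup :: "nat \<Rightarrow> nat set \<Rightarrow> nat set \<Rightarrow> (nat \<Rightarrow> nat) set"
  where "young_subgroup k A B = {p. p permutes A} <#>\<^bsub>sym_group k\<^esub> {p. p permutes B}"

definition transitive_implies_cyclic_conjecture :: "nat \<Rightarrow> bool"
  where "transitive_implies_cyclic_conjecture k \<longleftrightarrow>
    (\<forall>n. \<not> k dvd n \<longrightarrow>
      \<not> (\<exists>f \<in> hom (braid_group k) (sym_group n).
          transitive_hom (braid_group k) n f \<and> \<not> cyclic_hom (braid_group k) n f))"

end

(* H is the injective image of S_2 x S_{k-2}, so Lagrange gives its index.
   A left coset pH determines the pair p{1,2}; since (1 2)(2 3) maps {1,2} to {2,3} while
   (2 3)(1 2) maps it to {1,3}, the images of sigma_1 and sigma_2 do not commute, which is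
   impossible in a cyclic group. *)
theory Submission
  imports Defs
begin

section \<open>Young subgroups as internal direct products, and their index\<close>

text \<open>Each permutation preserves its own domain and is the identity elsewhere, so at any point
  at most one factor acts. This is what makes composition multiplicative on pairs from the two
  symmetric groups.\<close>

lemma permutes_disjoint_commute:
  assumes "p permutes A" "q permutes B" "A \<inter> B = {}"
  shows "p \<circ> q = q \<circ> p"
proof
  fix x
  consider "x \<in> A" "x \<notin> B" | "x \<in> B" "x \<notin> A" | "x \<notin> A" "x \<notin> B"
    using assms(3) by blast
  then show "(p \<circ> q) x = (q \<circ> p) x"
  proof cases
    case 1
    then have "p x \<in> A" "p x \<notin> B"
      using permutes_in_image[OF assms(1)] assms(3) by blast+
    then show ?thesis using 1 permutes_not_in[OF assms(2)] by simp
  next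
    case 2
    then have "q x \<in> B" "q x \<notin> A"
      using permutes_in_image[OF assms(2)] assms(3) by blast+
    then show ?thesis using 2 permutes_not_in[OF assms(1)] by simp
  qed (simp add: permutes_not_in[OF assms(1)] permutes_not_in[OF assms(2)])
qed

text \<open>On \<open>A\<close> the right factor is the identity, so the composite determines the
  left factor there, and off \<open>A\<close> the left factor is the identity. Cancelling it
  recovers the right factor.\<close>

lemma permutes_disjoint_comp_inj:
  assumes "A \<inter> B = {}"
  shows "inj_on (\<lambda>(p, q). p \<circ> q) ({p. p permutes A} \<times> {q. q permutes B})"
proof (rule inj_onI, clarsimp)
  fix p q p' q'
  assume p: "p permutes A" "p' permutes A" and q: "q permutes B" "q' permutes B"
    and eq: "p \<circ> q = p' \<circ> q'"
  have "p x = p' x" for x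
  proof (cases "x \<in> A")
    case True
    then have "x \<notin> B" using assms by blast
    then have "q x = x" "q' x = x" using q by (simp_all add: permutes_not_in)
    then show ?thesis using fun_cong[OF eq, of x] by simp
  qed (use p in \<open>simp add: permutes_not_in\<close>)
  then have "p = p'" by blast
  moreover from this have "q = q'"
    using eq permutes_inj[OF p(2)] by (auto simp: fun_eq_iff inj_def)
  ultimately show "p = p' \<and> q = q'" by blast
qed

text \<open>Transport along the inverse bijection undoes transport along \<open>f\<close>. This
  carries the symmetric group on an initial segment onto that of any finite set numbered by
  it.\<close>

lemma map_permutation_bij_betw:
  assumes "bij_betw f A B"
  shows "bij_betw (map_permutation A f) {p. p permutes A} {p. p permutes B}"
proof (rule bij_betw_byWitness[where f' = "map_permutation B (inv_into A f)"])
  have inv: "bij_betw (inv_into A f) B A" by (rule bij_betw_inv_into[OF assms])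
  show "\<forall>p\<in>{p. p permutes A}. map_permutation B (inv_into A f) (map_permutation A f p) = p"
    using assms by (auto intro!: map_permutation_compose_inv simp: bij_betw_inv_into_left)
  show "\<forall>p\<in>{p. p permutes B}. map_permutation A f (map_permutation B (inv_into A f) p) = p"
    using inv assms by (auto intro!: map_permutation_compose_inv simp: bij_betw_inv_into_right)
  show "map_permutation A f ` {p. p permutes A} \<subseteq> {p. p permutes B}"
    using assms by (auto intro: map_permutation_permutes)
  show "map_permutation B (inv_into A f) ` {p. p permutes B} \<subseteq> {p. p permutes A}"
    using inv by (auto intro: map_permutation_permutes)
qed

lemma young_subgroup_eq_image:
  "young_subgroup k A B = (\<lambda>(p, q). p \<circ> q) ` ({p. p permutes A} \<times> {q. q permutes B})"
  by (force simp: young_subgroup_def set_mult_def sym_group_mult)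

text \<open>Number \<open>A\<close> and \<open>B\<close>, transport the standard symmetric groups
  along the numberings, and compose the results. Subgroup property, isomorphism type and order all
  come from this one map \<open>h\<close>.\<close>

lemma young_subgroup_decomposition:
  assumes "A \<inter> B = {}" "A \<union> B \<subseteq> {1..k}"
  obtains h where "h \<in> hom (sym_group (card A) \<times>\<times> sym_group (card B)) (sym_group k)"
    and "inj_on h (carrier (sym_group (card A) \<times>\<times> sym_group (card B)))"
    and "h ` carrier (sym_group (card A) \<times>\<times> sym_group (card B)) = young_subgroup k A B"
proof -
  define a b where "a = card A" and "b = card B"
  have "finite A" "finite B" using assms(2) by (auto intro: finite_subset)
  then obtain f g where f: "bij_betw f {1..a} A" and g: "bij_betw g {1..b} B"
    unfolding a_def b_def
    by (metis card_atLeastAtMost diff_Suc_1 finite_atLeastAtMost finite_same_card_bij)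
  define F G where "F = map_permutation {1..a} f" and "G = map_permutation {1..b} g"
  have F: "bij_betw F {p. p permutes {1..a}} {p. p permutes A}"
    and G: "bij_betw G {p. p permutes {1..b}} {p. p permutes B}"
    unfolding F_def G_def using f g by (auto intro: map_permutation_bij_betw)
  have carr: "carrier (sym_group a \<times>\<times> sym_group b) = {p. p permutes {1..a}} \<times> {p. p permutes {1..b}}"
    by (simp add: sym_group_def)
  have FG: "bij_betw (map_prod F G) (carrier (sym_group a \<times>\<times> sym_group b))
      ({p. p permutes A} \<times> {q. q permutes B})"
    unfolding carr using F G by (rule bij_betw_map_prod)
  define h where "h = (\<lambda>(p, q). p \<circ> q) \<circ> map_prod F G"
  show thesis
  proof (rule that[of h, folded a_def b_def])
    show "inj_on h (carrier (sym_group a \<times>\<times> sym_group b))"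
      unfolding h_def using FG permutes_disjoint_comp_inj[OF assms(1)]
      by (simp add: bij_betw_def comp_inj_on)
    show "h ` carrier (sym_group a \<times>\<times> sym_group b) = young_subgroup k A B"
      unfolding h_def image_comp[symmetric] young_subgroup_eq_image bij_betw_imp_surj_on[OF FG] ..
    show "h \<in> hom (sym_group a \<times>\<times> sym_group b) (sym_group k)"
    proof (rule homI)
      fix x assume "x \<in> carrier (sym_group a \<times>\<times> sym_group b)"
      then obtain p q where x: "x = (p, q)" and pq: "p permutes {1..a}" "q permutes {1..b}"
        unfolding carr by blast
      then have Fp: "F p permutes A" and Gq: "G q permutes B"
        using F G by (auto simp: bij_betw_def)
      then show "h x \<in> carrier (sym_group k)"
        using assms(2) by (auto simp: x h_def sym_group_carrier intro!: permutes_compose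
            intro: permutes_subset)
      fix y assume "y \<in> carrier (sym_group a \<times>\<times> sym_group b)"
      then obtain p' q' where y: "y = (p', q')" and pq': "p' permutes {1..a}" "q' permutes {1..b}"
        unfolding carr by blast
      then have Fp': "F p' permutes A" using F by (auto simp: bij_betw_def)
      have "F (p \<circ> p') = F p \<circ> F p'" "G (q \<circ> q') = G q \<circ> G q'"
        using f g pq' by (auto simp: F_def G_def bij_betw_def intro: map_permutation_compose')
      \<comment> \<open>Swapping the two inner factors turns
        \<open>F p \<circ> F p' \<circ> G q \<circ> G q'\<close> into
        \<open>h x \<circ> h y\<close>.\<close>
      moreover have "F p' \<circ> G q = G q \<circ> F p'"
        using Fp' Gq assms(1) by (rule permutes_disjoint_commute)
      ultimately show "h (x \<otimes>\<^bsub>sym_group a \<times>\<times> sym_group b\<^esub> y) = h x \<otimes>\<^bsub>sym_group k\<^esub> h y"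
        by (simp add: x y h_def sym_group_mult) (metis comp_assoc)
    qed
  qed
qed

lemma
  assumes "A \<inter> B = {}" "A \<union> B \<subseteq> {1..k}"
  shows young_subgroup_subgroup: "subgroup (young_subgroup k A B) (sym_group k)"
    and young_subgroup_iso:
      "(sym_group k)\<lparr>carrier := young_subgroup k A B\<rparr> \<cong> sym_group (card A) \<times>\<times> sym_group (card B)"
    and card_young_subgroup: "card (young_subgroup k A B) = fact (card A) * fact (card B)"
proof -
  let ?P = "sym_group (card A) \<times>\<times> sym_group (card B)"
  obtain h where h: "h \<in> hom ?P (sym_group k)" "inj_on h (carrier ?P)"
    "h ` carrier ?P = young_subgroup k A B"
    using young_subgroup_decomposition[OF assms] by blast
  have P: "group ?P" by (intro DirProd_group sym_group_is_group)
  interpret group_hom ?P "sym_group k" h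
    using P sym_group_is_group h(1) by (simp add: group_hom_def group_hom_axioms_def)
  show "subgroup (young_subgroup k A B) (sym_group k)"
    using img_is_subgroup h(3) by simp
  have "h \<in> iso ?P ((sym_group k)\<lparr>carrier := young_subgroup k A B\<rparr>)"
    using h by (auto simp: iso_def hom_def bij_betw_def)
  then show "(sym_group k)\<lparr>carrier := young_subgroup k A B\<rparr> \<cong> ?P"
    using P by (meson group.iso_sym is_isoI)
  have "card (young_subgroup k A B) = card (carrier ?P)"
    using h(2,3) card_image by metis
  then show "card (young_subgroup k A B) = fact (card A) * fact (card B)"
    by (simp add: card_cartesian_product sym_group_def card_permutations)
qed

text \<open>The factor on \<open>B\<close> fixes \<open>A\<close> pointwise and the factor on
  \<open>A\<close> preserves it. Hence the image of \<open>A\<close> is constant on a left coset,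
  which serves below to tell two cosets apart.\<close>

lemma young_subgroup_image:
  assumes "p \<in> young_subgroup k A B" "A \<inter> B = {}"
  shows "p ` A = A"
proof -
  obtain q r where q: "q permutes A" and r: "r permutes B" and p: "p = q \<circ> r"
    using assms(1) by (auto simp: young_subgroup_eq_image)
  have "r ` A = A" using permutes_not_in[OF r] assms(2) by force
  then show ?thesis by (metis p image_comp permutes_image[OF q])
qed

lemma young_subgroup_index:
  assumes "A \<inter> B = {}" "A \<union> B \<subseteq> {1..k}"
  shows "card (lcosets\<^bsub>sym_group k\<^esub> (young_subgroup k A B)) * (fact (card A) * fact (card B)) = fact k"
proof -
  interpret group "sym_group k" by (rule sym_group_is_group)
  have "finite (carrier (sym_group k))" by (simp add: sym_group_def finite_permutations)
  from l_lagrange[OF this young_subgroup_subgroup[OF assms]]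
  show ?thesis
    by (simp add: order_def card_young_subgroup[OF assms]) (simp add: sym_group_def card_permutations)
qed

lemma pair_stabilizer_index:
  assumes "k \<ge> 2"
  shows "card (lcosets\<^bsub>sym_group k\<^esub> (young_subgroup k {1, 2} {3..k})) = k * (k - 1) div 2"
proof -
  let ?c = "card (lcosets\<^bsub>sym_group k\<^esub> (young_subgroup k {1, 2} {3..k}))"
  \<comment> \<open>With \<open>k = m + 2\<close> the set \<open>{3..k}\<close> has \<open>m\<close>
    elements and \<open>fact k\<close> is \<open>(m + 2) * (m + 1) * fact m\<close>, so
    \<open>fact m\<close> cancels from the index formula without truncated subtraction.\<close>
  obtain m where k: "k = m + 2" using assms by (metis add.commute le_Suc_ex)
  have "?c * (fact (card {1, 2 :: nat}) * fact (card {3..k})) = fact k"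
    by (rule young_subgroup_index) (use assms in auto)
  then have "(?c * 2) * fact m = ((m + 2) * (m + 1)) * fact m"
    by (simp add: k fact_2 algebra_simps)
  then have "?c * 2 = (m + 2) * (m + 1)"
    by (metis fact_nonzero mult_right_cancel)
  then show ?thesis unfolding k by simp
qed

section \<open>The action by left multiplication on numbered cosets\<close>

context group
begin

lemma lcoset_in_lcosets: "a \<in> carrier G \<Longrightarrow> a <# H \<in> lcosets H"
  by (auto simp: LCOSETS_def)

lemma lcosets_closed:
  assumes "H \<subseteq> carrier G" "g \<in> carrier G" "C \<in> lcosets H"
  shows "g <# C \<in> lcosets H"
  using assms by (auto simp: LCOSETS_def lcos_m_assoc)

text \<open>Eliminates \<open>inv_into\<close>: once a point of \<open>{1..n}\<close> is written as
  \<open>\<phi> C\<close>, computing with \<open>coset_perm\<close> becomes computing with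
  cosets.\<close>

lemma coset_perm_apply:
  assumes "bij_betw \<phi> (lcosets H) {1..n}" "C \<in> lcosets H"
  shows "coset_perm G H n \<phi> g (\<phi> C) = \<phi> (g <# C)"
  using assms bij_betw_apply[OF assms] by (simp add: coset_perm_def bij_betw_inv_into_left)

lemma coset_perm_mult:
  assumes H: "H \<subseteq> carrier G" and \<phi>: "bij_betw \<phi> (lcosets H) {1..n}"
    and g: "g \<in> carrier G" "h \<in> carrier G"
  shows "coset_perm G H n \<phi> (g \<otimes> h) = coset_perm G H n \<phi> g \<circ> coset_perm G H n \<phi> h"
proof
  fix x
  show "coset_perm G H n \<phi> (g \<otimes> h) x = (coset_perm G H n \<phi> g \<circ> coset_perm G H n \<phi> h) x"
  proof (cases "x \<in> {1..n}")
    case True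
    then obtain C where C: "C \<in> lcosets H" "x = \<phi> C"
      using bij_betw_imp_surj_on[OF \<phi>] by blast
    then have "C \<subseteq> carrier G" using H l_coset_subset_G by (auto simp: LCOSETS_def)
    then show ?thesis
      using C g by (simp add: coset_perm_apply[OF \<phi>] lcosets_closed[OF H] lcos_m_assoc)
  qed (auto simp: coset_perm_def)
qed

lemma coset_perm_one:
  assumes H: "H \<subseteq> carrier G" and \<phi>: "bij_betw \<phi> (lcosets H) {1..n}"
  shows "coset_perm G H n \<phi> \<one> = id"
proof
  fix x
  show "coset_perm G H n \<phi> \<one> x = id x"
  proof (cases "x \<in> {1..n}")
    case True
    then obtain C where C: "C \<in> lcosets H" "x = \<phi> C"
      using bij_betw_imp_surj_on[OF \<phi>] by blast
    then have "C \<subseteq> carrier G" using H l_coset_subset_G by (auto simp: LCOSETS_def)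
    then show ?thesis using C by (simp add: coset_perm_apply[OF \<phi>] lcos_mult_one)
  qed (auto simp: coset_perm_def)
qed

text \<open>Multiplicativity makes the action of \<open>inv g\<close> a two-sided inverse of that of
  \<open>g\<close>. Points outside \<open>{1..n}\<close> are fixed by the default branch of
  \<open>coset_perm\<close>.\<close>

lemma coset_perm_permutes:
  assumes H: "H \<subseteq> carrier G" and \<phi>: "bij_betw \<phi> (lcosets H) {1..n}" and g: "g \<in> carrier G"
  shows "coset_perm G H n \<phi> g permutes {1..n}"
proof -
  have "coset_perm G H n \<phi> g \<circ> coset_perm G H n \<phi> (inv g) = id"
    "coset_perm G H n \<phi> (inv g) \<circ> coset_perm G H n \<phi> g = id"
    using g by (simp_all add: coset_perm_mult[OF H \<phi>, symmetric] coset_perm_one[OF H \<phi>])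
  then have "bij (coset_perm G H n \<phi> g)" by (rule o_bij[rotated])
  then show ?thesis by (auto simp: permutes_def bij_iff coset_perm_def)
qed

lemma derived_hom_hom:
  assumes "H \<subseteq> carrier G" "bij_betw \<phi> (lcosets H) {1..n}" "\<mu> \<in> hom B G"
  shows "derived_hom G H n \<phi> \<mu> \<in> hom B (sym_group n)"
  using assms
  by (intro homI) (simp_all add: derived_hom_def sym_group_carrier sym_group_mult hom_mult
      coset_perm_mult coset_perm_permutes hom_in_carrier del: One_nat_def)

text \<open>The element \<open>b \<otimes> inv a\<close> carries the coset of \<open>a\<close> to
  that of \<open>b\<close>, and surjectivity of \<open>\<mu>\<close> lifts it to
  \<open>B\<close>.\<close>

lemma derived_hom_transitive:
  assumes H: "H \<subseteq> carrier G" and \<phi>: "bij_betw \<phi> (lcosets H) {1..n}" and \<mu>: "\<mu> \<in> epi B G"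
  shows "transitive_hom B n (derived_hom G H n \<phi> \<mu>)"
  unfolding transitive_hom_def
proof (intro ballI)
  fix x y assume "x \<in> {1..n}" "y \<in> {1..n}"
  then obtain C D where C: "C \<in> lcosets H" "x = \<phi> C" and D: "D \<in> lcosets H" "y = \<phi> D"
    using bij_betw_imp_surj_on[OF \<phi>] by blast
  obtain a b where a: "a \<in> carrier G" "C = a <# H" and b: "b \<in> carrier G" "D = b <# H"
    using C D by (auto simp: LCOSETS_def)
  have "(b \<otimes> inv a) <# C = D"
    using a b H by (simp add: lcos_m_assoc m_assoc)
  moreover obtain c where "c \<in> carrier B" "\<mu> c = b \<otimes> inv a"
    using \<mu> a b by (auto simp: epi_def) (metis imageE inv_closed m_closed)
  ultimately show "\<exists>p\<in>derived_hom G H n \<phi> \<mu> ` carrier B. p x = y"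
    using C D by (intro bexI[OF _ imageI]) (simp_all add: derived_hom_def coset_perm_apply[OF \<phi>])
qed

end

section \<open>Non-cyclicity\<close>

text \<open>The image is a group in its own right, and a cyclic group is abelian. Refuting cyclicity
  thus reduces to finding two elements whose images do not commute.\<close>

lemma cyclic_hom_commute:
  assumes "group G" "f \<in> hom G (sym_group n)" "cyclic_hom G n f" "x \<in> carrier G" "y \<in> carrier G"
  shows "f x \<circ> f y = f y \<circ> f x"
proof -
  interpret group_hom G "sym_group n" f
    using assms(1,2) sym_group_is_group by (simp add: group_hom_def group_hom_axioms_def)
  let ?I = "(sym_group n)\<lparr>carrier := f ` carrier G\<rparr>"
  have "group ?I" using img_is_subgroup by (rule H.subgroup_imp_group)
  then interpret I: comm_group ?I
    using assms(3) unfolding cyclic_hom_def by (rule group.cyclic_imp_abelian_group)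
  show ?thesis
    using I.m_comm[of "f x" "f y"] assms(4,5) by (simp add: sym_group_mult)
qed

lemma derived_hom_not_cyclic:
  assumes k: "k > 2" and H: "H = young_subgroup k {1, 2} {3..k}"
    and \<phi>: "bij_betw \<phi> (lcosets\<^bsub>sym_group k\<^esub> H) {1..n}"
  shows "\<not> cyclic_hom (braid_group k) n (derived_hom (sym_group k) H n \<phi> (canonical_epi k))"
proof
  interpret S: group "sym_group k" by (rule sym_group_is_group)
  \<comment> \<open>These are the images of the first two braid generators; \<open>k > 2\<close>
    guarantees that the second one exists.\<close>
  define s t where "s = transpose 1 (2::nat)" and "t = transpose 2 (3::nat)"
  have st: "s \<in> carrier (sym_group k)" "t \<in> carrier (sym_group k)"
    using k by (auto simp: s_def t_def sym_group_carrier intro: permutes_swap_id)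
  have sub: "subgroup H (sym_group k)"
    unfolding H by (rule young_subgroup_subgroup) (use k in auto)
  then have Hc: "H \<subseteq> carrier (sym_group k)" by (rule subgroup.subset)
  let ?f = "derived_hom (sym_group k) H n \<phi> (canonical_epi k)"
  assume cyc: "cyclic_hom (braid_group k) n ?f"
  have gen: "braid_gen k i \<in> carrier (braid_group k)" if "i \<in> {1..<k}" for i
    using that by (auto simp: braid_gen_def braid_words_def intro!: braid_class_closed)
  have "?f (braid_gen k 1) \<circ> ?f (braid_gen k 2) = ?f (braid_gen k 2) \<circ> ?f (braid_gen k 1)"
    by (rule cyclic_hom_commute[OF group_braid_group
          S.derived_hom_hom[OF Hc \<phi> canonical_epi_hom] cyc gen gen]) (use k in auto)
  moreover have "canonical_epi k (braid_gen k 1) = s" "canonical_epi k (braid_gen k 2) = t"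
    using k by (auto simp: canonical_epi_gen s_def t_def numeral_eq_Suc)
  ultimately have "coset_perm (sym_group k) H n \<phi> (s \<circ> t) = coset_perm (sym_group k) H n \<phi> (t \<circ> s)"
    using S.coset_perm_mult[OF Hc \<phi>] st by (simp add: derived_hom_def sym_group_mult)
  moreover have st': "s \<circ> t \<in> carrier (sym_group k)" "t \<circ> s \<in> carrier (sym_group k)"
    using st S.m_closed by (auto simp: sym_group_mult)
  \<comment> \<open>\<open>H\<close> is the coset of the identity. Evaluating both permutations at
    its number, and using injectivity of \<open>\<phi>\<close>, turns equal permutations into equal
    cosets.\<close>
  moreover have H': "H \<in> lcosets\<^bsub>sym_group k\<^esub> H"
    using S.lcoset_in_lcosets[of id H] S.lcos_mult_one[OF Hc] S.one_closed by (simp add: sym_group_one)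
  ultimately have "\<phi> ((s \<circ> t) <#\<^bsub>sym_group k\<^esub> H) = \<phi> ((t \<circ> s) <#\<^bsub>sym_group k\<^esub> H)"
    using S.coset_perm_apply[OF \<phi> H'] by metis
  then have "(s \<circ> t) <#\<^bsub>sym_group k\<^esub> H = (t \<circ> s) <#\<^bsub>sym_group k\<^esub> H"
    using bij_betw_imp_inj_on[OF \<phi>] st' by (auto dest: inj_onD simp: S.lcoset_in_lcosets)
  then have "s \<circ> t \<in> (t \<circ> s) <#\<^bsub>sym_group k\<^esub> H"
    using S.lcos_self[OF st'(1) sub] by simp
  then obtain p where p: "p \<in> H" "s \<circ> t = t \<circ> s \<circ> p"
    by (auto simp: l_coset_def sym_group_mult)
  have "p ` {1, 2} = {1, 2}"
    using p(1) unfolding H by (rule young_subgroup_image) auto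
  \<comment> \<open>In \<open>t \<circ> s \<circ> p\<close> the factor \<open>p\<close> acts first
    and preserves \<open>{1, 2}\<close>, so it drops out of the image.\<close>
  then have "(s \<circ> t) ` {1, 2} = (t \<circ> s) ` {1, 2}"
    unfolding p(2) image_comp[symmetric] by simp
  then show False by (auto simp: s_def t_def transpose_def)
qed

section \<open>Divisibility of the degree, and the counterexample\<close>

text \<open>For \<open>k = 2 * m\<close> the number is \<open>m * (2 * m - 1)\<close>. Divisibility
  by \<open>2 * m\<close> would, after cancelling the positive \<open>m\<close>, make the odd number
  \<open>2 * m - 1\<close> even.\<close>

lemma even_not_dvd_triangular:
  fixes k :: nat
  assumes "even k" "k > 0"
  shows "\<not> k dvd k * (k - 1) div 2"
proof
  obtain m where k: "k = 2 * m" using assms(1) by blast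
  assume "k dvd k * (k - 1) div 2"
  then have "m * 2 dvd m * (2 * m - 1)" by (simp add: k mult.commute mult.assoc)
  then have "even (2 * m - 1)" using assms(2) k by (simp only: dvd_mult_cancel1 nat_mult_dvd_cancel_disj) auto
  then show False using assms(2) k by simp
qed

(* For k = 2 the image of f lies in the trivial group S_1, so f is cyclic;
   non-cyclicity and the refutation are therefore stated for k > 2. *)
theorem mainTheorem6:
  fixes k n :: nat and H :: "(nat \<Rightarrow> nat) set"
  assumes k: "k \<ge> 2"
    and n: "n = k * (k - 1) div 2"
    and H: "H = young_subgroup k {1, 2} {3..k}"
  shows
    "subgroup H (sym_group k)
   \<and> (sym_group k)\<lparr>carrier := H\<rparr> \<cong> sym_group 2 \<times>\<times> sym_group (k - 2)
   \<and> card (lcosets\<^bsub>sym_group k\<^esub> H) = n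
   \<and> (\<forall>\<phi> f. bij_betw \<phi> (lcosets\<^bsub>sym_group k\<^esub> H) {1..n} \<longrightarrow>
        f = derived_hom (sym_group k) H n \<phi> (canonical_epi k) \<longrightarrow>
          f \<in> hom (braid_group k) (sym_group n)
        \<and> (\<forall>i\<in>{1..<k}. f (braid_gen k i) = coset_perm (sym_group k) H n \<phi> (transpose i (i + 1)))
        \<and> transitive_hom (braid_group k) n f
        \<and> (k > 2 \<longrightarrow> \<not> cyclic_hom (braid_group k) n f))
   \<and> (even k \<longrightarrow> \<not> k dvd n)
   \<and> (even k \<and> k > 2 \<longrightarrow> \<not> transitive_implies_cyclic_conjecture k)"
proof -
  interpret S: group "sym_group k" by (rule sym_group_is_group)
  have disj: "{1, 2} \<inter> {3..k} = {}" "{1, 2} \<union> {3..k} \<subseteq> {1..k}" using k by auto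
  have sub: "subgroup H (sym_group k)"
    unfolding H using disj by (rule young_subgroup_subgroup)
  have iso: "(sym_group k)\<lparr>carrier := H\<rparr> \<cong> sym_group 2 \<times>\<times> sym_group (k - 2)"
    using young_subgroup_iso[OF disj] k by (simp add: H numeral_2_eq_2)
  have index: "card (lcosets\<^bsub>sym_group k\<^esub> H) = n"
    unfolding H n using k by (rule pair_stabilizer_index)
  have derived: "derived_hom (sym_group k) H n \<phi> (canonical_epi k) \<in> hom (braid_group k) (sym_group n)"
      "transitive_hom (braid_group k) n (derived_hom (sym_group k) H n \<phi> (canonical_epi k))"
      "k > 2 \<Longrightarrow> \<not> cyclic_hom (braid_group k) n (derived_hom (sym_group k) H n \<phi> (canonical_epi k))"
    if "bij_betw \<phi> (lcosets\<^bsub>sym_group k\<^esub> H) {1..n}" for \<phi>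
    using S.derived_hom_hom[OF subgroup.subset[OF sub] that canonical_epi_hom]
      S.derived_hom_transitive[OF subgroup.subset[OF sub] that canonical_epi_epi]
      derived_hom_not_cyclic[OF _ H that] by auto
  have ndvd: "\<not> k dvd n" if "even k"
    using even_not_dvd_triangular[OF that] k n by simp
  have conj: "\<not> transitive_implies_cyclic_conjecture k" if "even k" "k > 2"
  proof -
    \<comment> \<open>Everything divides 0, so \<open>n\<close> is nonzero. As infinite sets have
      \<open>card\<close> 0, the coset set is then finite and a numbering \<open>\<phi>\<close>
      exists; the refutation needs an actual one, not just a claim about all of them.\<close>
    have "n > 0" using ndvd[OF \<open>even k\<close>] by (cases n) auto
    then have "finite (lcosets\<^bsub>sym_group k\<^esub> H)" using index by (metis card_ge_0_finite)
    then obtain \<phi> where "bij_betw \<phi> (lcosets\<^bsub>sym_group k\<^esub> H) {1..n}"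
      using index finite_same_card_bij[of _ "{1..n}"] by auto
    from derived[OF this] show ?thesis
      using ndvd that unfolding transitive_implies_cyclic_conjecture_def by blast
  qed
  show ?thesis
    using sub iso index derived ndvd conj by (auto simp: derived_hom_def canonical_epi_gen)
qed

end
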